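(* Let $(X,d)$ be a uniformly convex geodesic space that admits a monotone modulus of uniform convexity $\eta:(0,2]\times(0,\infty)\to(0,1]$. Then $X$ is uniformly uniquely geodesic and $\Phi:(0,\infty)^2\to(0,\infty)$ defined by $$\Phi(\varepsilon,b)=\frac{\varepsilon}{2}\,\eta\!\left(\frac{\varepsilon}{b+\varepsilon/2},\,b+\varepsilon/2\right)$$ is a modulus of uniform uniqueness for $X$. In addition, if $\eta$ can be written as $\eta(\varepsilon,r)=\varepsilon\,\tilde\eta(\varepsilon,r)$, where $\tilde\eta:(0,2]\times(0,\infty)\to(0,1]$ is nondecreasing in $\varepsilon$, then $$\Phi(\varepsilon,b)=\varepsilon\,\tilde\eta\!\left(\frac{\varepsilon}{b+\varepsilon},\,b+\varepsilon\right)$$ is also a modulus of uniform uniqueness for $X$.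
   Context: A geodesic space is a metric space $(X,d)$ in which every two points $x,y$ are joined by a geodesic, i.e. a map $\gamma:[0,d(x,y)]\to X$ with $\gamma(0)=x$, $\gamma(d(x,y))=y$ and $d(\gamma(s),\gamma(s'))=|s-s'|$. A midpoint $m(x,y)$ of $x,y$ is a point $m$ with $d(m,x)=d(m,y)=\frac12 d(x,y)$. A geodesic space $(X,d)$ is uniformly convex if for all $\varepsilon\in(0,2]$ and $r>0$ there exists $\delta\in(0,1]$ such that for all $z,x,y\in X$ and all midpoints $m(x,y)$ of $x$ and $y$: $d(z,x)\le r$, $d(z,y)\le r$ and $d(x,y)\ge\varepsilon r$ imply $d(z,m(x,y))\le(1-\delta)r$. A map $\eta:(0,2]\times(0,\infty)\to(0,1]$ such that $\delta=\eta(\varepsilon,r)$ works for all such $\varepsilon,r$ is called a modulus of uniform convexity; it is monotone if it is nonincreasing in the second argument. A geodesic space $(X,d)$ is uniformly uniquely geodesic if for all $\varepsilon,b>0$ there exists $\varphi>0$ such that for all $x,y,z,w\in X$ with $d(x,y)\le b$ and all $t\in[0,1]$: $\max\{d(z,x),d(w,x)\}\le t\,d(x,y)$ and $\max\{d(z,y),d(w,y)\}\le(1-t)\,d(x,y)+\varphi$ imply $d(z,w)\le\varepsilon$. A map $\Phi:(0,\infty)^2\to(0,\infty)$ such that $\varphi=\Phi(\varepsilon,b)$ works for all $\varepsilon,b>0$ is called a modulus of uniform uniqueness. *)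

theory Defs
  imports "HOL-Analysis.Analysis"
begin

text \<open>
  A metric space \<open>(X,d)\<close> is given by a carrier set \<open>X\<close> and a distance \<open>d\<close> satisfying the library
  predicate \<^const>\<open>Metric_space\<close>. Maps with a restricted domain, such as geodesics and moduli, are
  total functions that are only constrained on that domain; moduli are curried.
\<close>

definition geodesic_between ::
    "'a set \<Rightarrow> ('a \<Rightarrow> 'a \<Rightarrow> real) \<Rightarrow> 'a \<Rightarrow> 'a \<Rightarrow> (real \<Rightarrow> 'a) \<Rightarrow> bool" where
  "geodesic_between X d x y \<gamma> \<longleftrightarrow>
     \<gamma> \<in> {0..d x y} \<rightarrow> X \<and> \<gamma> 0 = x \<and> \<gamma> (d x y) = y \<and>
     (\<forall>s\<in>{0..d x y}. \<forall>s'\<in>{0..d x y}. d (\<gamma> s) (\<gamma> s') = \<bar>s - s'\<bar>)"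

definition geodesic_space :: "'a set \<Rightarrow> ('a \<Rightarrow> 'a \<Rightarrow> real) \<Rightarrow> bool" where
  "geodesic_space X d \<longleftrightarrow>
     Metric_space X d \<and> (\<forall>x\<in>X. \<forall>y\<in>X. \<exists>\<gamma>. geodesic_between X d x y \<gamma>)"

definition is_midpoint :: "'a set \<Rightarrow> ('a \<Rightarrow> 'a \<Rightarrow> real) \<Rightarrow> 'a \<Rightarrow> 'a \<Rightarrow> 'a \<Rightarrow> bool" where
  "is_midpoint X d x y m \<longleftrightarrow> m \<in> X \<and> d m x = d x y / 2 \<and> d m y = d x y / 2"

text \<open>The following predicate says that \<open>\<delta>\<close> works for \<open>\<epsilon>\<close> and \<open>r\<close> in the definition of uniform
  convexity.\<close>

definition convexity_witness ::
    "'a set \<Rightarrow> ('a \<Rightarrow> 'a \<Rightarrow> real) \<Rightarrow> real \<Rightarrow> real \<Rightarrow> real \<Rightarrow> bool" where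
  "convexity_witness X d \<epsilon> r \<delta> \<longleftrightarrow>
     (\<forall>z\<in>X. \<forall>x\<in>X. \<forall>y\<in>X. \<forall>m. is_midpoint X d x y m \<longrightarrow>
        d z x \<le> r \<longrightarrow> d z y \<le> r \<longrightarrow> d x y \<ge> \<epsilon> * r \<longrightarrow> d z m \<le> (1 - \<delta>) * r)"

definition uniformly_convex :: "'a set \<Rightarrow> ('a \<Rightarrow> 'a \<Rightarrow> real) \<Rightarrow> bool" where
  "uniformly_convex X d \<longleftrightarrow>
     geodesic_space X d \<and>
     (\<forall>\<epsilon>\<in>{0<..2}. \<forall>r>0. \<exists>\<delta>\<in>{0<..1}. convexity_witness X d \<epsilon> r \<delta>)"

definition modulus_of_uniform_convexity ::
    "'a set \<Rightarrow> ('a \<Rightarrow> 'a \<Rightarrow> real) \<Rightarrow> (real \<Rightarrow> real \<Rightarrow> real) \<Rightarrow> bool" where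
  "modulus_of_uniform_convexity X d \<eta> \<longleftrightarrow>
     (\<forall>\<epsilon>\<in>{0<..2}. \<forall>r>0. \<eta> \<epsilon> r \<in> {0<..1} \<and> convexity_witness X d \<epsilon> r (\<eta> \<epsilon> r))"

definition monotone_modulus :: "(real \<Rightarrow> real \<Rightarrow> real) \<Rightarrow> bool" where
  "monotone_modulus \<eta> \<longleftrightarrow> (\<forall>\<epsilon>\<in>{0<..2}. antimono_on {0<..} (\<eta> \<epsilon>))"

text \<open>The following predicate says that \<open>\<phi>\<close> works for \<open>\<epsilon>\<close> and \<open>b\<close> in the definition of uniformly
  uniquely geodesic spaces.\<close>

definition uniqueness_witness ::
    "'a set \<Rightarrow> ('a \<Rightarrow> 'a \<Rightarrow> real) \<Rightarrow> real \<Rightarrow> real \<Rightarrow> real \<Rightarrow> bool" where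
  "uniqueness_witness X d \<epsilon> b \<phi> \<longleftrightarrow>
     (\<forall>x\<in>X. \<forall>y\<in>X. \<forall>z\<in>X. \<forall>w\<in>X. d x y \<le> b \<longrightarrow>
        (\<forall>t\<in>{0..1}.
           max (d z x) (d w x) \<le> t * d x y \<longrightarrow>
           max (d z y) (d w y) \<le> (1 - t) * d x y + \<phi> \<longrightarrow>
           d z w \<le> \<epsilon>))"

definition uniformly_uniquely_geodesic :: "'a set \<Rightarrow> ('a \<Rightarrow> 'a \<Rightarrow> real) \<Rightarrow> bool" where
  "uniformly_uniquely_geodesic X d \<longleftrightarrow>
     geodesic_space X d \<and>
     (\<forall>\<epsilon>>0. \<forall>b>0. \<exists>\<phi>>0. uniqueness_witness X d \<epsilon> b \<phi>)"

definition modulus_of_uniform_uniqueness ::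
    "'a set \<Rightarrow> ('a \<Rightarrow> 'a \<Rightarrow> real) \<Rightarrow> (real \<Rightarrow> real \<Rightarrow> real) \<Rightarrow> bool" where
  "modulus_of_uniform_uniqueness X d \<Phi> \<longleftrightarrow>
     (\<forall>\<epsilon>>0. \<forall>b>0. \<Phi> \<epsilon> b > 0 \<and> uniqueness_witness X d \<epsilon> b (\<Phi> \<epsilon> b))"

end

(* Suppose z, w satisfy the premises of uniform uniqueness but are more than \<epsilon> apart, and let m be a
   midpoint of z and w. Both points lie in a ball around x of radius r = t d(x,y) > \<epsilon>/2, so uniform
   convexity brings m closer to x by at least \<phi>; around y uniform convexity gives the strict
   inequality d(y,m) < (1-t) d(x,y) + \<phi>. Adding the two contradicts the triangle inequality. *)
theory Submission
  imports Defs
begin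

lemma geodesic_space_midpoint:
  assumes "geodesic_space X d" "x \<in> X" "y \<in> X"
  obtains m where "is_midpoint X d x y m"
proof -
  interpret Metric_space X d
    using assms by (simp add: geodesic_space_def)
  obtain \<gamma> where \<gamma>: "geodesic_between X d x y \<gamma>"
    using assms unfolding geodesic_space_def by blast
  let ?h = "d x y / 2"
  have h: "?h \<in> {0..d x y}" "0 \<in> {0..d x y}" "d x y \<in> {0..d x y}"
    by auto
  have "\<gamma> ?h \<in> X" "d (\<gamma> ?h) (\<gamma> 0) = \<bar>?h - 0\<bar>" "d (\<gamma> ?h) (\<gamma> (d x y)) = \<bar>?h - d x y\<bar>"
    using \<gamma> h unfolding geodesic_between_def by blast+
  moreover have "\<gamma> 0 = x" "\<gamma> (d x y) = y"
    using \<gamma> by (simp_all add: geodesic_between_def)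
  ultimately have "is_midpoint X d x y (\<gamma> ?h)"
    by (simp add: is_midpoint_def)
  then show thesis
    by (rule that)
qed

text \<open>Any positive value of the modulus yields strictness, so no quantitative lower bound on
  \<open>d z w\<close> is needed. This serves the ball around the second endpoint, whose radius is
  not tied to \<epsilon>.\<close>

lemma midpoint_dist_less:
  assumes "Metric_space X d" "modulus_of_uniform_convexity X d \<eta>"
    and "a \<in> X" "z \<in> X" "w \<in> X" "is_midpoint X d z w m"
    and "d a z \<le> r" "d a w \<le> r" "z \<noteq> w"
  shows "d a m < r"
proof -
  interpret Metric_space X d by fact
  have pos: "0 < d z w"
    using assms by simp
  have le: "d z w \<le> 2 * r"
    using triangle[of z a w] commute[of z a] assms by simp
  have r: "0 < r"
    using pos le by simp
  \<comment> \<open>The largest parameter that the convexity condition admits for z and w; it is at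
    most 2 by the triangle inequality through a.\<close>
  let ?e = "d z w / r"
  have e: "?e \<in> {0<..2}" "?e * r \<le> d z w"
    using pos le r by (auto simp: field_simps)
  have \<eta>: "0 < \<eta> ?e r" and "convexity_witness X d ?e r (\<eta> ?e r)"
    using assms(2) e(1) r unfolding modulus_of_uniform_convexity_def by auto
  then have "d a m \<le> (1 - \<eta> ?e r) * r"
    unfolding convexity_witness_def using assms(3-8) e(2) by simp
  also have "\<dots> < r"
    using \<eta> r by (simp add: algebra_simps)
  finally show ?thesis .
qed

text \<open>Separates the geometry from the formula for the modulus. In \<open>gain\<close>, r is
  the radius of the ball around x: \<open>e * r \<le> \<epsilon>\<close> makes e admissible for
  points more than \<epsilon> apart, and \<open>r * \<eta> e r\<close> is the amount by which their
  midpoint lies deeper in the ball. Since e may depend on r, both formulas are instances.\<close>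

lemma uniqueness_witnessI:
  assumes geo: "geodesic_space X d" and mod: "modulus_of_uniform_convexity X d \<eta>"
    and "0 < \<epsilon>"
    and gain: "\<And>r. \<epsilon> / 2 < r \<Longrightarrow> r \<le> b \<Longrightarrow> \<exists>e\<in>{0<..2}. e * r \<le> \<epsilon> \<and> \<phi> \<le> r * \<eta> e r"
  shows "uniqueness_witness X d \<epsilon> b \<phi>"
  unfolding uniqueness_witness_def
proof (intro ballI impI, rule ccontr)
  interpret Metric_space X d
    using geo by (simp add: geodesic_space_def)
  fix x y z w t
  assume X: "x \<in> X" "y \<in> X" "z \<in> X" "w \<in> X" and "d x y \<le> b" and t: "t \<in> {0..1::real}"
    and "max (d z x) (d w x) \<le> t * d x y"
    and "max (d z y) (d w y) \<le> (1 - t) * d x y + \<phi>"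
    and "\<not> d z w \<le> \<epsilon>"
  then have x: "d x z \<le> t * d x y" "d x w \<le> t * d x y"
    and y: "d y z \<le> (1 - t) * d x y + \<phi>" "d y w \<le> (1 - t) * d x y + \<phi>"
    and zw: "\<epsilon> < d z w"
    by (simp_all add: commute)
  let ?r = "t * d x y"
  \<comment> \<open>Two points of a ball are at most its diameter apart, hence the lower bound
    \<epsilon>/2 on the radius; it also makes the radius positive.\<close>
  have "d z w \<le> 2 * ?r"
    using triangle[of z x w] commute[of z x] x X by simp
  then have "\<epsilon> / 2 < ?r"
    using zw by simp
  moreover have "?r \<le> b"
    using mult_left_le_one_le[of "d x y" t] t \<open>d x y \<le> b\<close> by simp
  ultimately obtain e where e: "e \<in> {0<..2}" "e * ?r \<le> \<epsilon>" "\<phi> \<le> ?r * \<eta> e ?r"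
    using gain[of ?r] by blast
  obtain m where m: "is_midpoint X d z w m"
    by (rule geodesic_space_midpoint[OF geo X(3,4)])
  have "convexity_witness X d e ?r (\<eta> e ?r)"
    using mod e(1) \<open>\<epsilon> / 2 < ?r\<close> \<open>0 < \<epsilon>\<close> by (simp add: modulus_of_uniform_convexity_def)
  moreover have "e * ?r \<le> d z w"
    using e(2) zw by simp
  ultimately have "d x m \<le> (1 - \<eta> e ?r) * ?r"
    unfolding convexity_witness_def using X m x by simp
  then have "d x m \<le> ?r - \<phi>"
    using e(3) by (simp add: algebra_simps)
  moreover have "z \<noteq> w"
    using zw \<open>0 < \<epsilon>\<close> X by auto
  then have "d y m < (1 - t) * d x y + \<phi>"
    by (intro midpoint_dist_less[OF Metric_space_axioms mod X(2,3,4) m y])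
  moreover have "d x y \<le> d x m + d y m"
    using triangle[of x m y] commute[of m y] X m by (simp add: is_midpoint_def)
  ultimately show False
    by (simp add: algebra_simps)
qed

theorem theorem3p6:
  fixes X :: "'a set" and d :: "'a \<Rightarrow> 'a \<Rightarrow> real" and \<eta> :: "real \<Rightarrow> real \<Rightarrow> real"
  assumes "uniformly_convex X d"
    and "modulus_of_uniform_convexity X d \<eta>"
    and "monotone_modulus \<eta>"
  shows "uniformly_uniquely_geodesic X d \<and>
    modulus_of_uniform_uniqueness X d
      (\<lambda>\<epsilon> b. \<epsilon> / 2 * \<eta> (\<epsilon> / (b + \<epsilon> / 2)) (b + \<epsilon> / 2)) \<and>
    (\<forall>\<eta>' :: real \<Rightarrow> real \<Rightarrow> real.
      (\<forall>\<epsilon>\<in>{0<..2}. \<forall>r>0. \<eta>' \<epsilon> r \<in> {0<..1}) \<longrightarrow>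
      (\<forall>\<epsilon>\<in>{0<..2}. \<forall>r>0. \<eta> \<epsilon> r = \<epsilon> * \<eta>' \<epsilon> r) \<longrightarrow>
      (\<forall>r>0. mono_on {0<..2} (\<lambda>\<epsilon>. \<eta>' \<epsilon> r)) \<longrightarrow>
      modulus_of_uniform_uniqueness X d
        (\<lambda>\<epsilon> b. \<epsilon> * \<eta>' (\<epsilon> / (b + \<epsilon>)) (b + \<epsilon>)))"
proof (intro conjI allI impI)
  have geo: "geodesic_space X d"
    using assms(1) by (simp add: uniformly_convex_def)
  have range: "0 < \<eta> e r" if "e \<in> {0<..2}" "0 < r" for e r
    using assms(2) that unfolding modulus_of_uniform_convexity_def by auto
  have anti: "\<eta> e r' \<le> \<eta> e r" if "e \<in> {0<..2}" "0 < r" "r \<le> r'" for e r r'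
    using assms(3) that by (simp add: monotone_modulus_def monotone_on_def)
  show first: "modulus_of_uniform_uniqueness X d
      (\<lambda>\<epsilon> b. \<epsilon> / 2 * \<eta> (\<epsilon> / (b + \<epsilon> / 2)) (b + \<epsilon> / 2))"
    unfolding modulus_of_uniform_uniqueness_def
  proof (intro allI impI conjI)
    fix \<epsilon> b :: real
    assume pos: "0 < \<epsilon>" "0 < b"
    \<comment> \<open>This radius dominates every r \<le> b, and 2R \<ge> \<epsilon> keeps
      \<epsilon>/R within (0,2].\<close>
    let ?R = "b + \<epsilon> / 2"
    let ?e = "\<epsilon> / ?R"
    have e: "?e \<in> {0<..2}"
      using pos by (auto simp: field_simps)
    have \<eta>: "0 < \<eta> ?e ?R"
      using range e pos by simp
    then show "0 < \<epsilon> / 2 * \<eta> ?e ?R"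
      using pos by simp
    show "uniqueness_witness X d \<epsilon> b (\<epsilon> / 2 * \<eta> ?e ?R)"
    \<comment> \<open>One e serves all radii: passing from r to R can only decrease \<eta>, and the
      factor \<epsilon>/2 is the lower bound for r.\<close>
    proof (rule uniqueness_witnessI[OF geo assms(2) pos(1)], rule bexI[OF _ e], rule conjI)
      fix r
      assume r: "\<epsilon> / 2 < r" "r \<le> b"
      then have "\<epsilon> * r \<le> \<epsilon> * ?R"
        using pos by (intro mult_left_mono) auto
      then show "?e * r \<le> \<epsilon>"
        using pos by (simp add: pos_divide_le_eq)
      show "\<epsilon> / 2 * \<eta> ?e ?R \<le> r * \<eta> ?e r"
        using r pos \<eta> anti[OF e, of r ?R] by (intro mult_mono) auto
    qed
  qed
  then show "uniformly_uniquely_geodesic X d"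
    using geo unfolding uniformly_uniquely_geodesic_def modulus_of_uniform_uniqueness_def by blast
  fix \<eta>' :: "real \<Rightarrow> real \<Rightarrow> real"
  assume range': "\<forall>\<epsilon>\<in>{0<..2}. \<forall>r>0. \<eta>' \<epsilon> r \<in> {0<..1}"
    and \<eta>': "\<forall>\<epsilon>\<in>{0<..2}. \<forall>r>0. \<eta> \<epsilon> r = \<epsilon> * \<eta>' \<epsilon> r"
    and mono: "\<forall>r>0. mono_on {0<..2} (\<lambda>\<epsilon>. \<eta>' \<epsilon> r)"
  show "modulus_of_uniform_uniqueness X d (\<lambda>\<epsilon> b. \<epsilon> * \<eta>' (\<epsilon> / (b + \<epsilon>)) (b + \<epsilon>))"
    unfolding modulus_of_uniform_uniqueness_def
  proof (intro allI impI conjI)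
    fix \<epsilon> b :: real
    assume pos: "0 < \<epsilon>" "0 < b"
    let ?R = "b + \<epsilon>"
    let ?e = "\<epsilon> / ?R"
    have e: "?e \<in> {0<..2}"
      using pos by (auto simp: field_simps)
    show "0 < \<epsilon> * \<eta>' ?e ?R"
      using range' e pos by simp
    show "uniqueness_witness X d \<epsilon> b (\<epsilon> * \<eta>' ?e ?R)"
    proof (rule uniqueness_witnessI[OF geo assms(2) pos(1)])
      fix r
      assume r: "\<epsilon> / 2 < r" "r \<le> b"
      then have r0: "0 < r"
        using pos by simp
      \<comment> \<open>Here e is chosen as \<epsilon>/r, so that \<open>e * r\<close> equals
        \<epsilon> and the gain \<open>r * \<eta> e r\<close> becomes \<epsilon> times
        \<open>\<eta>' e r\<close>, without the loss of a factor 2. The bound e \<le> 2 is exactly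
        where r > \<epsilon>/2 enters.\<close>
      have er: "\<epsilon> / r \<in> {0<..2}"
        using r r0 pos by (auto simp: field_simps)
      \<comment> \<open>The arguments are changed one at a time: first the radius, where
        \<open>\<eta>'\<close> inherits monotonicity from \<eta> by cancelling the common factor,
        then the first argument, raised to \<epsilon>/r.\<close>
      have "?e * \<eta>' ?e ?R \<le> ?e * \<eta>' ?e r"
        using anti[OF e r0, of ?R] \<eta>' e r r0 pos by simp
      then have "\<eta>' ?e ?R \<le> \<eta>' ?e r"
        using e by (simp only: mult_le_cancel_left_pos greaterThanAtMost_iff)
      also have "?e \<le> \<epsilon> / r"
        using r r0 pos by (intro divide_left_mono) auto
      then have "\<eta>' ?e r \<le> \<eta>' (\<epsilon> / r) r"
        using mono_onD[OF mono[rule_format, OF r0] e er] by simp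
      finally have "\<epsilon> * \<eta>' ?e ?R \<le> \<epsilon> * \<eta>' (\<epsilon> / r) r"
        using pos by simp
      also have "\<dots> = r * \<eta> (\<epsilon> / r) r"
        using \<eta>' er r0 by simp
      finally show "\<exists>e\<in>{0<..2}. e * r \<le> \<epsilon> \<and> \<epsilon> * \<eta>' ?e ?R \<le> r * \<eta> e r"
        using er r0 by (intro bexI[of _ "\<epsilon> / r"]) auto
    qed
  qed
qed

end
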